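(* Let $G$ be a strongly regular graph. The line graph of $G$ is closed distance magic if and only if $G$ is a cycle of order $3$.
   Context: Graphs are finite and simple. A distance-regular graph is a regular connected graph with degree $r$ and diameter $d$, for which there are positive integers $b_0=r,b_1,\ldots,b_{d-1},c_1=1,c_2,\ldots,c_d$ such that for any two vertices $u,v$ at distance $i$, there are precisely $c_i$ neighbours of $u$ at distance $i-1$ from $v$ ($1\le i\le d$) and precisely $b_i$ neighbours of $u$ at distance $i+1$ from $v$ ($0\le i\le d-1$). A strongly regular graph is a distance-regular graph of diameter at most $2$. The line graph of $G$ has the edges of $G$ as its vertices, two being adjacent when the edges share an endpoint. A graph $H$ on $n$ vertices is closed distance magic if there exist a bijection $f:V(H)\to\{1,2,\ldots,n\}$ and a constant $k$ such that $\sum_{y\in N[x]}f(y)=k$ for every vertex $x$, where $N[x]$ is the closed neighbourhood of $x$, i.e. the set consisting of $x$ and all vertices adjacent to $x$.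
   Formalization: The line graph of G is assumed to have at least two vertices, which excludes only the one-vertex graph and the single edge K_2; K_2 is a counterexample to the claim as worded, since its line graph is a single vertex and trivially closed distance magic. *)

theory Defs
  imports
    "Graph_Theory.Digraph_Isomorphism"
    "Graph_Theory.Shortest_Path"
begin

text \<open>
  A finite simple graph is a \<open>pair_graph\<close>: a finite set of vertices together with a symmetric
  irreflexive adjacency relation. Every undirected edge thus appears as two opposite arcs.
\<close>

definition neighbours :: "'a pair_pre_digraph \<Rightarrow> 'a \<Rightarrow> 'a set" where
  "neighbours G u = {w. (u, w) \<in> parcs G}"

definition graph_dist :: "'a pair_pre_digraph \<Rightarrow> 'a \<Rightarrow> 'a \<Rightarrow> ereal" where
  "graph_dist G u v = wf_digraph.\<mu> (with_proj G) (\<lambda>_. 1) u v"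

definition diameter :: "'a pair_pre_digraph \<Rightarrow> ereal" where
  "diameter G = (SUP u \<in> pverts G. SUP v \<in> pverts G. graph_dist G u v)"

text \<open>
  Only the entries \<open>b i\<close> with \<open>i < d\<close> and \<open>c i\<close> with \<open>1 \<le> i \<le> d\<close> of the intersection array are
  constrained to be positive, so the one-vertex graph (degree and diameter \<open>0\<close>) is distance-regular.
\<close>

definition distance_regular :: "'a pair_pre_digraph \<Rightarrow> nat \<Rightarrow> nat \<Rightarrow> bool" where
  "distance_regular G r d \<longleftrightarrow>
     pair_graph G \<and> connected (with_proj G) \<and>
     (\<forall>u \<in> pverts G. card (neighbours G u) = r) \<and>
     diameter G = ereal (real d) \<and>
     (\<exists>b c :: nat \<Rightarrow> nat.
        b 0 = r \<and> c 1 = 1 \<and>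
        (\<forall>i. i < d \<longrightarrow> 0 < b i) \<and>
        (\<forall>i. 1 \<le> i \<and> i \<le> d \<longrightarrow> 0 < c i) \<and>
        (\<forall>u \<in> pverts G. \<forall>v \<in> pverts G. \<forall>i :: nat. graph_dist G u v = ereal (real i) \<longrightarrow>
           (1 \<le> i \<and> i \<le> d \<longrightarrow>
              card {w \<in> neighbours G u. graph_dist G w v = ereal (real (i - 1))} = c i) \<and>
           (i < d \<longrightarrow>
              card {w \<in> neighbours G u. graph_dist G w v = ereal (real (i + 1))} = b i)))"

definition strongly_regular :: "'a pair_pre_digraph \<Rightarrow> bool" where
  "strongly_regular G \<longleftrightarrow> (\<exists>r d. distance_regular G r d \<and> d \<le> 2)"

definition edges :: "'a pair_pre_digraph \<Rightarrow> 'a set set" where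
  "edges G = {{u, v} | u v. (u, v) \<in> parcs G}"

definition line_graph :: "'a pair_pre_digraph \<Rightarrow> 'a set pair_pre_digraph" where
  "line_graph G = \<lparr> pverts = edges G,
     parcs = {(e, f). e \<in> edges G \<and> f \<in> edges G \<and> e \<noteq> f \<and> e \<inter> f \<noteq> {}} \<rparr>"

text \<open>
  A graph with at most one vertex is trivially closed distance magic. This applies to the line
  graphs of the complete graphs on one and two vertices, which are distance-regular.
\<close>

definition closed_distance_magic :: "'a pair_pre_digraph \<Rightarrow> bool" where
  "closed_distance_magic H \<longleftrightarrow>
     (\<exists>(f :: 'a \<Rightarrow> nat) (k :: nat).
        bij_betw f (pverts H) {1..card (pverts H)} \<and>
        (\<forall>x \<in> pverts H. (\<Sum>y \<in> insert x (neighbours H x). f y) = k))"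

text \<open>Only meaningful as a simple graph for \<open>n \<ge> 3\<close>.\<close>

definition cycle_graph :: "nat \<Rightarrow> nat pair_pre_digraph" where
  "cycle_graph n = \<lparr> pverts = {..<n},
     parcs = {(i, j). i < n \<and> j < n \<and> (j = (i + 1) mod n \<or> i = (j + 1) mod n)} \<rparr>"

definition is_cycle_of_order :: "'a pair_pre_digraph \<Rightarrow> nat \<Rightarrow> bool" where
  "is_cycle_of_order G n \<longleftrightarrow> digraph_iso (with_proj G) (with_proj (cycle_graph n))"

end

theory Submission
  imports Defs
begin

text \<open>
  If \<open>s u\<close> is the sum of the labels at \<open>u\<close>, the magic condition reads \<open>f {u, v} = s u + s v - k\<close>.
  Summing over the neighbours of \<open>u\<close> turns \<open>s\<close>, suitably rescaled and shifted, into an integral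
  eigenvector \<open>t\<close> of \<open>G\<close> with eigenvalue \<open>1 - r\<close>, and injectivity of \<open>f\<close> says that distinct edges
  have distinct sums \<open>t u + t v\<close>. In a complete graph the eigenvalue must be \<open>-1\<close>, so \<open>r = 2\<close>. Otherwise,
  with \<open>l\<close> and \<open>m\<close> the numbers of common neighbours of adjacent and of nonadjacent vertices,
  the quadratic equation for the eigenvalues becomes \<open>(r - 2) * (r - 1 - m) + l * (r - 1) = 1\<close>.
  This leaves only the parameters \<open>(r, 1, r)\<close>, which no graph has, and those of the Petersen graph
  \<open>(3, 0, 1)\<close>, where the eigenvector takes the same sum on different edges.
\<close>

section \<open>Regularity, eigenvectors and neighbourhoods\<close>

definition regular_graph :: "'a pair_pre_digraph \<Rightarrow> nat \<Rightarrow> bool" where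
  "regular_graph G r \<longleftrightarrow> (\<forall>u \<in> pverts G. card (neighbours G u) = r)"

definition eigenvector :: "'a pair_pre_digraph \<Rightarrow> int \<Rightarrow> ('a \<Rightarrow> int) \<Rightarrow> bool" where
  "eigenvector G \<theta> t \<longleftrightarrow> (\<forall>u \<in> pverts G. (\<Sum>v \<in> neighbours G u. t v) = \<theta> * t u)"

text \<open>The usual parameters without the order. Complete graphs satisfy the last clause for
  every \<open>m\<close>, so they are treated as a separate case.\<close>

definition srg :: "'a pair_pre_digraph \<Rightarrow> nat \<Rightarrow> nat \<Rightarrow> nat \<Rightarrow> bool" where
  "srg G r l m \<longleftrightarrow> regular_graph G r \<and>
     (\<forall>u \<in> pverts G. \<forall>v \<in> neighbours G u. card (neighbours G u \<inter> neighbours G v) = l) \<and>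
     (\<forall>u \<in> pverts G. \<forall>v \<in> pverts G. u \<noteq> v \<longrightarrow> v \<notin> neighbours G u \<longrightarrow>
        card (neighbours G u \<inter> neighbours G v) = m)"

definition complete_graph :: "'a pair_pre_digraph \<Rightarrow> bool" where
  "complete_graph G \<longleftrightarrow> (\<forall>u \<in> pverts G. neighbours G u = pverts G - {u})"

lemma in_pverts_line_graph_iff: "e \<in> pverts (line_graph G) \<longleftrightarrow> (\<exists>u v. e = {u, v} \<and> (u, v) \<in> parcs G)"
  by (auto simp: line_graph_def edges_def)

lemma card_eq_1_unique: "card A = 1 \<Longrightarrow> x \<in> A \<Longrightarrow> y \<in> A \<Longrightarrow> x = y"
  by (metis card_1_singletonE singletonD)

context pair_graph
begin

lemma neighbours_iff: "v \<in> neighbours G u \<longleftrightarrow> (u, v) \<in> parcs G"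
  by (simp add: neighbours_def)

lemma neighbours_sym: "v \<in> neighbours G u \<longleftrightarrow> u \<in> neighbours G v"
  using arcs_symmetric by (auto simp: neighbours_iff)

lemma neighbours_subset: "neighbours G u \<subseteq> pverts G"
  using in_arcsD2 by (auto simp: neighbours_iff)

lemma neighbours_irrefl: "u \<notin> neighbours G u"
  using no_loops' by (auto simp: neighbours_iff)

lemma finite_neighbours: "finite (neighbours G u)"
  using finite_subset[OF neighbours_subset pair_finite_verts] .

lemma finite_edges: "finite (edges G)"
proof -
  have "edges G = (\<lambda>(u, v). {u, v}) ` parcs G"
    by (auto simp: edges_def)
  then show ?thesis using pair_finite_arcs by simp
qed

section \<open>Distances at most two\<close>

lemma graph_dist_le_length:
  assumes "awalk u p v"
  shows "graph_dist G u v \<le> ereal (real (length p))"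
  using min_cost_le_walk_cost[OF assms, of "\<lambda>_. 1"]
  by (simp add: graph_dist_def awalk_cost_def sum_list_triv)

lemma graph_dist_geI:
  assumes "\<And>p. awalk u p v \<Longrightarrow> n \<le> length p"
  shows "ereal (real n) \<le> graph_dist G u v"
  unfolding graph_dist_def \<mu>_def
  using assms by (auto intro!: INF_greatest simp: awalk_cost_def sum_list_triv)

lemma graph_dist_self:
  assumes "u \<in> pverts G"
  shows "graph_dist G u u = ereal (real 0)"
proof (rule antisym)
  show "graph_dist G u u \<le> ereal (real 0)"
    using graph_dist_le_length[of u "[]" u] assms by (simp add: awalk_Nil_iff)
  show "ereal (real 0) \<le> graph_dist G u u"
    by (rule graph_dist_geI) simp
qed

lemma graph_dist_adjacent:
  assumes "v \<in> neighbours G u"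
  shows "graph_dist G u v = ereal (real 1)"
proof (rule antisym)
  have "awalk u [(u, v)] v"
    using assms in_arcsD1 in_arcsD2 by (auto simp: awalk_simps neighbours_iff)
  from graph_dist_le_length[OF this] show "graph_dist G u v \<le> ereal (real 1)"
    by simp
  have "u \<noteq> v"
    using assms neighbours_irrefl by auto
  then show "ereal (real 1) \<le> graph_dist G u v"
    by (intro graph_dist_geI) (auto simp: awalk_Nil_iff Suc_le_eq)
qed

lemma graph_dist_nonadjacent:
  assumes "u \<noteq> v" "v \<notin> neighbours G u"
  shows "ereal (real 2) \<le> graph_dist G u v"
proof (rule graph_dist_geI)
  fix p assume p: "awalk u p v"
  show "2 \<le> length p"
  proof (cases p)
    case Nil
    then show ?thesis using p assms by (simp add: awalk_Nil_iff)
  next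
    case (Cons a q)
    then show ?thesis
      using p assms by (cases q) (auto simp: awalk_simps neighbours_iff)
  qed
qed

lemma graph_dist_le_diameter:
  assumes "u \<in> pverts G" "v \<in> pverts G"
  shows "graph_dist G u v \<le> diameter G"
  unfolding diameter_def using assms by (meson SUP_upper2 order_refl)

text \<open>Distinct nonadjacent vertices are at distance at least 2, and the diameter caps it
  there. Conditions on distances thus become conditions on adjacency.\<close>

lemma graph_dist_cases:
  assumes "diameter G \<le> ereal 2" "u \<in> pverts G" "v \<in> pverts G"
  shows "graph_dist G u v =
    ereal (real (if u = v then 0 else if v \<in> neighbours G u then 1 else 2))"
  using assms graph_dist_self graph_dist_adjacent graph_dist_nonadjacent[of u v]
    order_trans[OF graph_dist_le_diameter[of u v] assms(1)]
  by auto

text \<open>The parameters are \<open>m = c 2\<close> and \<open>l = r - 1 - b 1\<close>. A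
  nonadjacent pair forces \<open>d = 2\<close>, hence \<open>b 1 > 0\<close>, which is where
  \<open>l + 2 \<le> r\<close> comes from.\<close>

lemma distance_regular_imp_srg:
  assumes dr: "distance_regular G r d" and d: "d \<le> 2" and nc: "\<not> complete_graph G"
  obtains l m where "srg G r l m" "l + 2 \<le> r" "m \<le> r"
proof -
  let ?N = "neighbours G"
  have diam: "diameter G = ereal (real d)" and reg: "\<And>u. u \<in> pverts G \<Longrightarrow> card (?N u) = r"
    using dr by (auto simp: distance_regular_def)
  obtain b c :: "nat \<Rightarrow> nat" where b0: "b 0 = r" and bpos: "\<forall>i. i < d \<longrightarrow> 0 < b i"
    and bc: "\<forall>u \<in> pverts G. \<forall>v \<in> pverts G. \<forall>i. graph_dist G u v = ereal (real i) \<longrightarrow>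
      (1 \<le> i \<and> i \<le> d \<longrightarrow> card {w \<in> ?N u. graph_dist G w v = ereal (real (i - 1))} = c i) \<and>
      (i < d \<longrightarrow> card {w \<in> ?N u. graph_dist G w v = ereal (real (i + 1))} = b i)"
    using dr unfolding distance_regular_def by (elim conjE exE) blast
  have diam2: "diameter G \<le> ereal 2"
    using diam d by simp
  note dist = graph_dist_cases[OF diam2]
  obtain x y where xy: "x \<in> pverts G" "y \<in> pverts G" "x \<noteq> y" "y \<notin> ?N x"
    using nc neighbours_subset neighbours_irrefl unfolding complete_graph_def by blast
  have "d = 2"
    using graph_dist_le_diameter[OF xy(1,2)] dist[OF xy(1,2)] xy(3,4) diam d by simp
  have common: "?N u \<inter> ?N v = {w \<in> ?N u. graph_dist G w v = ereal (real 1)}"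
    if "u \<in> pverts G" "v \<in> pverts G" for u v
  proof -
    have "w \<in> ?N v \<longleftrightarrow> graph_dist G w v = ereal (real 1)" if "w \<in> ?N u" for w
    proof -
      have "w \<in> pverts G"
        using that neighbours_subset by auto
      then show ?thesis
        using dist[of w v] neighbours_sym[of v w] neighbours_irrefl \<open>v \<in> pverts G\<close> by auto
    qed
    then show ?thesis by blast
  qed
  have nonadj: "card (?N u \<inter> ?N v) = c 2"
    if "u \<in> pverts G" "v \<in> pverts G" "u \<noteq> v" "v \<notin> ?N u" for u v
    using bc[rule_format, OF that(1,2), of 2] dist[OF that(1,2)] that common[OF that(1,2)] \<open>d = 2\<close>
    by simp
  have adj: "card (?N u \<inter> ?N v) + 1 + b 1 = r" if "u \<in> pverts G" "v \<in> ?N u" for u v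
  proof -
    have v: "v \<in> pverts G"
      using that neighbours_subset by auto
    let ?B = "{w \<in> ?N u. graph_dist G w v = ereal (real 2)}"
    have "card ?B = b 1"
      using bc[rule_format, OF that(1) v, of 1] dist[OF that(1) v] that neighbours_irrefl \<open>d = 2\<close>
      by (auto split: if_splits)
    \<comment> \<open>The neighbours of \<open>u\<close> are sorted by their distance 1, 0 or 2 from
      \<open>v\<close>.\<close>
    moreover have "?N u = (?N u \<inter> ?N v) \<union> {v} \<union> ?B"
      using common[OF that(1) v] dist[of _ v] that v neighbours_subset[of u]
      by (fastforce split: if_splits)
    moreover have "card ((?N u \<inter> ?N v) \<union> {v} \<union> ?B) = card (?N u \<inter> ?N v) + 1 + card ?B"
    proof -
      have "((?N u \<inter> ?N v) \<union> {v}) \<inter> ?B = {}"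
        using common[OF that(1) v] graph_dist_self[OF v] by auto
      moreover have "(?N u \<inter> ?N v) \<inter> {v} = {}"
        using neighbours_irrefl by auto
      ultimately show ?thesis
        using finite_neighbours by (simp add: card_Un_disjoint del: Un_insert_right)
    qed
    ultimately show ?thesis
      using reg[OF that(1)] by simp
  qed
  have "0 < r"
    using bpos b0 \<open>d = 2\<close> by fastforce
  then have "?N x \<noteq> {}"
    using reg[OF xy(1)] by auto
  then obtain z where "z \<in> ?N x" by blast
  have "b 1 > 0"
    using bpos \<open>d = 2\<close> by simp
  show thesis
  proof (rule that)
    show "srg G r (r - 1 - b 1) (c 2)"
      unfolding srg_def regular_graph_def using reg nonadj adj by fastforce
    \<comment> \<open>Truncated subtraction does no harm: \<open>adj\<close> at the edge
      \<open>xz\<close> gives \<open>1 + b 1 \<le> r\<close>.\<close>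
    show "r - 1 - b 1 + 2 \<le> r"
      using adj[OF xy(1) \<open>z \<in> ?N x\<close>] \<open>b 1 > 0\<close> by simp
    show "c 2 \<le> r"
      using nonadj[OF xy] reg[OF xy(1)] finite_neighbours card_mono[of "?N x" "?N x \<inter> ?N y"]
      by auto
  qed
qed

section \<open>Eigenvectors of regular and strongly regular graphs\<close>

text \<open>Double counting: by symmetry of adjacency, \<open>t w\<close> occurs once for each
  vertex of \<open>A\<close> that is a neighbour of \<open>w\<close>.\<close>

lemma sum_sum_neighbours:
  fixes t :: "'a \<Rightarrow> int"
  assumes "finite A"
  shows "(\<Sum>v\<in>A. \<Sum>w\<in>neighbours G v. t w) = (\<Sum>w\<in>pverts G. int (card (A \<inter> neighbours G w)) * t w)"
proof -
  have N: "neighbours G v = {w \<in> pverts G. w \<in> neighbours G v}" for v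
    using neighbours_subset by auto
  have A: "{v \<in> A. w \<in> neighbours G v} = A \<inter> neighbours G w" for w
    using neighbours_sym by auto
  have "(\<Sum>v\<in>A. \<Sum>w\<in>neighbours G v. t w)
      = (\<Sum>v\<in>A. \<Sum>w\<in>{w \<in> pverts G. w \<in> neighbours G v}. t w)"
    using N by simp
  also have "\<dots> = (\<Sum>w\<in>pverts G. \<Sum>v\<in>{v \<in> A. w \<in> neighbours G v}. t w)"
    by (rule sum.swap_restrict[OF assms pair_finite_verts])
  also have "\<dots> = (\<Sum>w\<in>pverts G. int (card (A \<inter> neighbours G w)) * t w)"
    by (simp add: A)
  finally show ?thesis .
qed

text \<open>Orthogonality to the constants, which have eigenvalue \<open>r\<close>: summing the
  eigenvalue equation over all vertices gives \<theta> times the total on one side and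
  \<open>r\<close> times the total on the other.\<close>

lemma eigenvector_sum_eq_0:
  assumes "regular_graph G r" "eigenvector G \<theta> t" "\<theta> \<noteq> int r"
  shows "(\<Sum>u\<in>pverts G. t u) = 0"
proof -
  have "\<theta> * (\<Sum>u\<in>pverts G. t u) = (\<Sum>u\<in>pverts G. \<Sum>v\<in>neighbours G u. t v)"
    using assms(2) by (simp add: eigenvector_def sum_distrib_left)
  also have "\<dots> = (\<Sum>w\<in>pverts G. int r * t w)"
    unfolding sum_sum_neighbours[OF pair_finite_verts]
    using assms(1) neighbours_subset
    by (intro sum.cong) (auto simp: regular_graph_def Int_absorb1)
  finally show ?thesis
    using assms(3) by (simp add: sum_distrib_left[symmetric])
qed

text \<open>Apply \<open>A\<^sup>2 = r I + l A + m (J - I - A)\<close>, with \<open>A\<close> the adjacency matrix, to an eigenvector orthogonal to the constants.\<close>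

lemma srg_eigenvalue:
  assumes "srg G r l m" "eigenvector G \<theta> t" "\<theta> \<noteq> int r" "x \<in> pverts G" "t x \<noteq> 0"
  shows "\<theta> * \<theta> = (int l - int m) * \<theta> + int r - int m"
proof -
  let ?N = "neighbours G"
  \<comment> \<open>Row \<open>x\<close> of the squared adjacency matrix: \<open>m\<close>
    everywhere, corrected to \<open>l\<close> at neighbours and to \<open>r\<close> at
    \<open>x\<close> itself.\<close>
  have card: "int (card (?N x \<inter> ?N w)) * t w = int m * t w
      + (if w \<in> ?N x then (int l - int m) * t w else 0) + (if w = x then (int r - int m) * t w else 0)"
    if "w \<in> pverts G" for w
    using assms(1,4) that neighbours_irrefl unfolding srg_def regular_graph_def
    by (auto simp: algebra_simps)
  have "\<theta> * \<theta> * t x = (\<Sum>v\<in>?N x. \<theta> * t v)"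
    using assms(2,4) by (simp add: eigenvector_def sum_distrib_left[symmetric])
  also have "\<dots> = (\<Sum>v\<in>?N x. \<Sum>w\<in>?N v. t w)"
    using assms(2) neighbours_subset[of x] by (intro sum.cong) (auto simp: eigenvector_def)
  also have "\<dots> = (\<Sum>w\<in>pverts G. int m * t w
      + (if w \<in> ?N x then (int l - int m) * t w else 0) + (if w = x then (int r - int m) * t w else 0))"
    unfolding sum_sum_neighbours[OF finite_neighbours] by (intro sum.cong card refl)
  also have "\<dots> = int m * (\<Sum>w\<in>pverts G. t w) + (int l - int m) * (\<Sum>w\<in>?N x. t w)
      + (int r - int m) * t x"
    using pair_finite_verts assms(4) neighbours_subset[of x]
    by (simp add: sum.distrib sum_distrib_left sum.inter_restrict[symmetric] Int_absorb1)
  also have "\<dots> = ((int l - int m) * \<theta> + int r - int m) * t x"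
    using assms(1,2,4) eigenvector_sum_eq_0[OF _ assms(2,3)] unfolding srg_def
    by (simp add: eigenvector_def algebra_simps)
  finally show ?thesis
    using assms(5) by simp
qed

text \<open>Since \<open>m = r\<close>, nonadjacent vertices have equal neighbourhoods. Let
  \<open>w\<close> be the one common neighbour of the adjacent \<open>u\<close> and
  \<open>v\<close>. A third neighbour \<open>v'\<close> of \<open>u\<close> is not adjacent to
  \<open>v\<close>, hence is adjacent to \<open>w\<close>, so \<open>u\<close> and \<open>w\<close>
  have the two common neighbours \<open>v\<close> and \<open>v'\<close>, against
  \<open>l = 1\<close>.\<close>

lemma no_srg_r_1_r:
  assumes "srg G r 1 r" "3 \<le> r" "u \<in> pverts G"
  shows False
proof -
  let ?N = "neighbours G"
  have r: "\<And>u. u \<in> pverts G \<Longrightarrow> card (?N u) = r"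
    and adj: "\<And>u v. v \<in> ?N u \<Longrightarrow> card (?N u \<inter> ?N v) = 1"
    and non: "\<And>u v. u \<in> pverts G \<Longrightarrow> v \<in> pverts G \<Longrightarrow> u \<noteq> v \<Longrightarrow> v \<notin> ?N u \<Longrightarrow> card (?N u \<inter> ?N v) = r"
    using assms(1) neighbours_subset neighbours_sym unfolding srg_def regular_graph_def by blast+
  have "?N u \<noteq> {}"
    using r[OF assms(3)] assms(2) by auto
  then obtain v where v: "v \<in> ?N u" by blast
  obtain w where w: "?N u \<inter> ?N v = {w}"
    using adj[OF v] by (auto simp: card_1_singleton_iff)
  have "\<not> ?N u \<subseteq> {v, w}"
    using r[OF assms(3)] assms(2) card_mono[of "{v, w}" "?N u"] card_insert_le_m1[of 2 "{w}" v]
    by fastforce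
  then obtain v' where v': "v' \<in> ?N u" "v' \<noteq> v" "v' \<noteq> w" by blast
  have "v' \<notin> ?N v"
    using v' w by auto
  have V: "v \<in> pverts G" "v' \<in> pverts G"
    using v v' neighbours_subset by auto
  have "card (?N v \<inter> ?N v') = card (?N v)"
    using non[OF V] r V v' \<open>v' \<notin> ?N v\<close> by simp
  then have "?N v \<inter> ?N v' = ?N v"
    by (intro card_subset_eq) (auto simp: finite_neighbours)
  then have "w \<in> ?N v'"
    using w by auto
  then have "v \<in> ?N u \<inter> ?N w" "v' \<in> ?N u \<inter> ?N w"
    using v v' w neighbours_sym by auto
  moreover have "w \<in> ?N u"
    using w by auto
  ultimately show False
    using card_eq_1_unique[OF adj] v'(2) by blast
qed

text \<open>The edges at distance two from \<open>uv\<close> in the Petersen graph form, together with \<open>uv\<close>, the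
  three edges of a matching on which the sum of \<open>t\<close> over the endpoints is constant.\<close>

lemma petersen_equal_edge_sums:
  assumes "srg G 3 0 1" "eigenvector G (- 2) t" "v \<in> neighbours G u"
  obtains z z' where "z' \<in> neighbours G z" "{z, z'} \<noteq> {u, v}" "t z + t z' = t u + t v"
proof -
  let ?N = "neighbours G"
  have reg: "\<And>u v. v \<in> ?N u \<Longrightarrow> card (?N u) = 3"
    and adj: "\<And>u v w. v \<in> ?N u \<Longrightarrow> w \<in> ?N u \<Longrightarrow> w \<in> ?N v \<Longrightarrow> False"
    and non: "\<And>u v. u \<in> pverts G \<Longrightarrow> v \<in> pverts G \<Longrightarrow> u \<noteq> v \<Longrightarrow> v \<notin> ?N u \<Longrightarrow> card (?N u \<inter> ?N v) = 1"
  proof -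
    show "card (?N u) = 3" if "v \<in> ?N u" for u v
      using assms(1) that in_arcsD1 by (auto simp: srg_def regular_graph_def neighbours_iff)
    show False if "v \<in> ?N u" "w \<in> ?N u" "w \<in> ?N v" for u v w
    proof -
      have "card (?N u \<inter> ?N v) = 0"
        using assms(1) that(1) in_arcsD1 by (auto simp: srg_def neighbours_iff)
      then show False
        using that(2,3) finite_neighbours by auto
    qed
    show "card (?N u \<inter> ?N v) = 1"
      if "u \<in> pverts G" "v \<in> pverts G" "u \<noteq> v" "v \<notin> ?N u" for u v
      using assms(1) that by (simp add: srg_def)
  qed
  have V: "x \<in> pverts G" "y \<in> pverts G" if "x \<in> ?N y" for x y
    using that neighbours_subset neighbours_sym by blast+
  \<comment> \<open>No 4-cycles: vertices with a common neighbour are nonadjacent as there are no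
    triangles, and then \<open>m = 1\<close> applies.\<close>
  have uniq: "w = w'" if "w \<in> ?N x" "w \<in> ?N y" "w' \<in> ?N x" "w' \<in> ?N y" "x \<noteq> y" for x y w w'
  proof (rule card_eq_1_unique)
    have "y \<notin> ?N x"
      using that adj by blast
    then show "card (?N x \<inter> ?N y) = 1"
      using non that V by blast
  qed (use that in auto)
  have ex: "\<exists>w. w \<in> ?N x \<and> w \<in> ?N y" if "x \<in> pverts G" "y \<in> pverts G" "x \<noteq> y" "y \<notin> ?N x" for x y
    using non[OF that] by (metis IntE card_1_singletonE singletonI)
  have third: "\<exists>c. ?N x = {a, b, c} \<and> c \<noteq> a \<and> c \<noteq> b" if "a \<in> ?N x" "b \<in> ?N x" "a \<noteq> b" for x a b
  proof -
    have "card (?N x - {a, b}) = 1"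
      using reg[OF that(1)] that finite_neighbours by (simp add: card_Diff_subset)
    then obtain c where "?N x - {a, b} = {c}"
      by (auto simp: card_1_singleton_iff)
    then have "?N x = {a, b, c} \<and> c \<noteq> a \<and> c \<noteq> b"
      using that by blast
    then show ?thesis by blast
  qed
  have sum3: "t a + t b + t c = - 2 * t x"
    if "?N x = {a, b, c}" "a \<noteq> b" "c \<noteq> a" "c \<noteq> b" for x a b c
  proof -
    have "x \<in> pverts G"
      using V(2)[of a x] that by auto
    then have "(\<Sum>w\<in>{a, b, c}. t w) = - 2 * t x"
      using assms(2) that(1) unfolding eigenvector_def by metis
    then show ?thesis
      using that by auto
  qed
  have two: "\<exists>b. b \<in> ?N x \<and> b \<noteq> a" if "a \<in> ?N x" for x a
  proof (rule ccontr)
    assume "\<not> ?thesis"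
    then have "?N x \<subseteq> {a}" by blast
    from card_mono[OF _ this] show False
      using reg[OF that] by simp
  qed
  have uv: "u \<in> ?N v" "u \<noteq> v"
    using assms(3) neighbours_sym neighbours_irrefl by auto
  \<comment> \<open>The path \<open>u\<close>, \<open>p\<close>, \<open>z\<close> leads away from
    \<open>uv\<close>. As \<open>p\<close> is the only common neighbour of \<open>u\<close> and
    \<open>z\<close>, the vertex \<open>z\<close> is not adjacent to \<open>v\<close>.\<close>
  obtain p where p: "p \<in> ?N u" "p \<noteq> v"
    using two[OF assms(3)] by blast
  then have "u \<in> ?N p"
    using neighbours_sym by blast
  then obtain z where z: "z \<in> ?N p" "z \<noteq> u"
    using two by blast
  have zp: "p \<in> ?N z"
    using z neighbours_sym by blast
  have zu: "z \<notin> ?N u" "u \<notin> ?N z"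
    using z p adj neighbours_sym by blast+
  have zv: "z \<notin> ?N v" "z \<noteq> v"
    using uniq[of p u z v] z p zp zu assms(3) neighbours_sym by blast+
  obtain x where x: "x \<in> ?N z" "x \<in> ?N v"
    using ex[of z v] zv V z assms(3) neighbours_sym by metis
  have "x \<noteq> u" "x \<noteq> p"
    using x zu p adj assms(3) by blast+
  \<comment> \<open>Two neighbours of \<open>z\<close> lead to \<open>u\<close> and
    \<open>v\<close>; the third gives the edge \<open>zz'\<close> at distance two from
    \<open>uv\<close>. Then \<open>q\<close> and \<open>y\<close> join \<open>z'\<close> to
    \<open>u\<close> and \<open>v\<close> in the same way.\<close>
  obtain z' where z': "?N z = {p, x, z'}" "z' \<noteq> p" "z' \<noteq> x"
    using third[OF zp x(1)] \<open>x \<noteq> p\<close> by metis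
  have z'z: "z' \<in> ?N z" "z \<in> ?N z'"
    using z' neighbours_sym by auto
  have z'u: "z' \<notin> ?N u" "z' \<noteq> u"
    using uniq[of p u z z'] z'z z' zp p z zu neighbours_sym by blast+
  have z'v: "z' \<notin> ?N v" "z' \<noteq> v"
    using uniq[of x v z z'] z'z z' x zv neighbours_sym by blast+
  obtain q where q: "q \<in> ?N z'" "q \<in> ?N u"
    using ex[of z' u] z'u V z'z p neighbours_sym by metis
  obtain y where y: "y \<in> ?N z'" "y \<in> ?N v"
    using ex[of z' v] z'v V z'z x neighbours_sym by metis
  have "q \<noteq> v" "q \<noteq> p"
    using q z'v zp z'z adj neighbours_sym by blast+
  have "y \<noteq> u" "y \<noteq> x"
    using y z'u x z'z adj neighbours_sym by blast+
  have "q \<noteq> y" "z \<noteq> q" "z \<noteq> y"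
    using q y assms(3) adj zu zv by blast+
  obtain a where a: "?N u = {v, p, a}" "a \<noteq> v" "a \<noteq> p"
    using third[OF assms(3) p(1)] p by metis
  have "a = q"
    using a q \<open>q \<noteq> v\<close> \<open>q \<noteq> p\<close> by auto
  obtain b where b: "?N v = {u, x, b}" "b \<noteq> u" "b \<noteq> x"
    using third[OF uv(1) x(2)] \<open>x \<noteq> u\<close> by metis
  have "b = y"
    using b y \<open>y \<noteq> u\<close> \<open>y \<noteq> x\<close> by auto
  obtain c where c: "?N z' = {q, y, c}" "c \<noteq> q" "c \<noteq> y"
    using third[OF q(1) y(1)] \<open>q \<noteq> y\<close> by metis
  have "c = z"
    using c z'z \<open>z \<noteq> q\<close> \<open>z \<noteq> y\<close> by auto
  have "t v + t p + t q = - 2 * t u"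
    using sum3[OF a(1)] a p \<open>a = q\<close> by auto
  moreover have "t u + t x + t y = - 2 * t v"
    using sum3[OF b(1)] b \<open>x \<noteq> u\<close> \<open>b = y\<close> by auto
  moreover have "t p + t x + t z' = - 2 * t z"
    using sum3[OF z'(1)] z' \<open>x \<noteq> p\<close> by auto
  moreover have "t q + t y + t z = - 2 * t z'"
    using sum3[OF c(1)] c \<open>q \<noteq> y\<close> \<open>c = z\<close> by auto
  \<comment> \<open>The first two equations and the last two each add up to
    \<open>t p + t q + t x + t y\<close> plus an edge sum on the left. Subtracting leaves three
    times the claim.\<close>
  ultimately have "t z + t z' = t u + t v"
    by linarith
  moreover have "{z, z'} \<noteq> {u, v}"
    using z zv by auto
  ultimately show thesis
    using that z'z by blast
qed

section \<open>Closed distance magic labelings of line graphs\<close>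

text \<open>The edges meeting \<open>{u, v}\<close> form the stars of its two ends, so the magic
  sums can be expressed by vertex sums.\<close>

lemma closed_neighbourhood_line_graph:
  assumes "(u, v) \<in> parcs G"
  shows "insert {u, v} (neighbours (line_graph G) {u, v})
    = (\<lambda>w. {u, w}) ` neighbours G u \<union> (\<lambda>w. {v, w}) ` neighbours G v"
proof (rule set_eqI)
  fix e
  have "e \<in> insert {u, v} (neighbours (line_graph G) {u, v}) \<longleftrightarrow> e \<in> edges G \<and> {u, v} \<inter> e \<noteq> {}"
    using assms by (auto simp: neighbours_def line_graph_def edges_def)
  also have "\<dots> \<longleftrightarrow> e \<in> (\<lambda>w. {u, w}) ` neighbours G u \<union> (\<lambda>w. {v, w}) ` neighbours G v"
    using arcs_symmetric by (fastforce simp: edges_def neighbours_def)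
  finally show "e \<in> insert {u, v} (neighbours (line_graph G) {u, v}) \<longleftrightarrow>
    e \<in> (\<lambda>w. {u, w}) ` neighbours G u \<union> (\<lambda>w. {v, w}) ` neighbours G v" .
qed

lemma closed_distance_magic_imp_eigenvector:
  assumes "closed_distance_magic (line_graph G)" "regular_graph G r"
  obtains t where "eigenvector G (1 - int r) t"
    "\<And>u v x y. v \<in> neighbours G u \<Longrightarrow> y \<in> neighbours G x \<Longrightarrow> t u + t v = t x + t y \<Longrightarrow> {u, v} = {x, y}"
proof -
  obtain f k where f: "inj_on f (pverts (line_graph G))"
    and magic: "\<And>e. e \<in> pverts (line_graph G) \<Longrightarrow>
      (\<Sum>y \<in> insert e (neighbours (line_graph G) e). f y) = (k::nat)"
    using assms(1) unfolding closed_distance_magic_def bij_betw_def by blast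
  define s where "s u = (\<Sum>w\<in>neighbours G u. int (f {u, w}))" for u
  have label: "int (f {u, v}) = s u + s v - int k" if "v \<in> neighbours G u" for u v
  proof -
    let ?E = "\<lambda>u. (\<lambda>w. {u, w}) ` neighbours G u"
    have uv: "(u, v) \<in> parcs G" "u \<noteq> v"
      using that neighbours_iff neighbours_irrefl by auto
    have s: "s x = (\<Sum>e\<in>?E x. int (f e))" for x
      unfolding s_def by (subst sum.reindex) (auto simp: inj_on_def doubleton_eq_iff)
    \<comment> \<open>The two stars share only the edge \<open>uv\<close>, whose label is therefore
      counted twice in \<open>s u + s v\<close>.\<close>
    have "?E u \<inter> ?E v = {{u, v}}"
      using uv arcs_symmetric by (auto simp: neighbours_iff doubleton_eq_iff image_iff)
    then have "(\<Sum>e\<in>?E u \<union> ?E v. int (f e)) + int (f {u, v}) = s u + s v"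
      using sum.union_inter[of "?E u" "?E v" "\<lambda>e. int (f e)"] finite_neighbours by (simp add: s)
    moreover have "(\<Sum>e\<in>?E u \<union> ?E v. int (f e)) = int k"
      using magic[of "{u, v}"] uv unfolding closed_neighbourhood_line_graph[OF uv(1)]
      by (auto simp: in_pverts_line_graph_iff simp flip: of_nat_sum)
    ultimately show ?thesis by simp
  qed
  \<comment> \<open>The neighbour sums of \<open>s\<close> are \<open>(1 - r) * s u + r * k\<close>.
    The constant solution of this relation is \<open>r * k / (2 * r - 1)\<close>; subtracting it and
    clearing the denominator gives \<open>t\<close>.\<close>
  define t where "t u = (2 * int r - 1) * s u - int r * int k" for u
  show thesis
  proof (rule that)
    have "(\<Sum>v\<in>neighbours G u. t v) = (1 - int r) * t u" if "u \<in> pverts G" for u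
    proof -
      have r: "card (neighbours G u) = r"
        using assms(2) that by (simp add: regular_graph_def)
      have "s u = (\<Sum>v\<in>neighbours G u. s u + s v - int k)"
        by (subst s_def) (intro sum.cong refl label)
      then have "(\<Sum>v\<in>neighbours G u. s v) = (1 - int r) * s u + int r * int k"
        using r by (simp add: sum.distrib sum_subtractf algebra_simps)
      then show ?thesis
        using r by (simp add: t_def sum_subtractf sum_distrib_left[symmetric]) (simp add: algebra_simps)
    qed
    then show "eigenvector G (1 - int r) t"
      by (simp add: eigenvector_def)
  next
    fix u v x y
    assume *: "v \<in> neighbours G u" "y \<in> neighbours G x" "t u + t v = t x + t y"
    then have "(2 * int r - 1) * (s u + s v) = (2 * int r - 1) * (s x + s y)"
      by (simp add: t_def algebra_simps)
    moreover have "2 * int r - 1 \<noteq> 0" by presburger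
    ultimately have "f {u, v} = f {x, y}"
      using label[OF *(1)] label[OF *(2)] by simp
    then show "{u, v} = {x, y}"
      using inj_onD[OF f, of "{u, v}" "{x, y}"] *
      by (auto simp: in_pverts_line_graph_iff neighbours_iff simp del: doubleton_eq_iff)
  qed
qed

text \<open>The values at the neighbours of \<open>x\<close> add up to the total, which is zero,
  minus \<open>t x\<close>.\<close>

lemma eigenvector_complete_graph:
  assumes "complete_graph G" "eigenvector G \<theta> t" "(\<Sum>u\<in>pverts G. t u) = 0"
    "x \<in> pverts G" "t x \<noteq> 0"
  shows "\<theta> = - 1"
proof -
  have "\<theta> * t x = (\<Sum>v\<in>pverts G - {x}. t v)"
    using assms(1,2,4) by (simp add: eigenvector_def complete_graph_def)
  also have "\<dots> = - t x"
    using assms(3,4) pair_finite_verts by (simp add: sum_diff1)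
  finally have "(\<theta> + 1) * t x = 0"
    by (simp add: algebra_simps)
  then show ?thesis
    using assms(5) by simp
qed

end

text \<open>The first assumption is the eigenvalue equation at \<open>1 - r\<close>. If
  \<open>m < r\<close>, both summands of \<open>eq\<close> are nonnegative and
  \<open>l \<ge> 1\<close> would make the second at least 2; so \<open>l = 0\<close> and the two
  factors of the first are 1.\<close>

lemma srg_parameters:
  fixes r l m :: int
  assumes "(1 - r) * (1 - r) = (l - m) * (1 - r) + r - m" "0 \<le> l" "l + 2 \<le> r" "m \<le> r"
  shows "r = 3 \<and> l = 0 \<and> m = 1 \<or> 3 \<le> r \<and> l = 1 \<and> m = r"
proof -
  have eq: "(r - 2) * (r - 1 - m) + l * (r - 1) = 1"
    using assms(1) by (simp add: algebra_simps)
  have "r \<noteq> 2"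
    using eq assms(2,3) by auto
  then have "3 \<le> r"
    using assms(2,3) by simp
  show ?thesis
  proof (cases "m = r")
    case True
    then have "(l - 1) * (r - 1) = 0"
      using eq by (simp add: algebra_simps)
    then show ?thesis
      using \<open>3 \<le> r\<close> True by simp
  next
    case False
    then have nonneg: "0 \<le> (r - 2) * (r - 1 - m)"
      using \<open>3 \<le> r\<close> assms(4) by simp
    have "l = 0"
    proof (rule ccontr)
      assume "l \<noteq> 0"
      then have "r - 1 \<le> l * (r - 1)"
        using assms(2) \<open>3 \<le> r\<close> mult_right_mono[of 1 l "r - 1"] by simp
      then show False
        using eq nonneg \<open>3 \<le> r\<close> by linarith
    qed
    then have "r - 2 = 1 \<and> r - 1 - m = 1"
      using eq \<open>3 \<le> r\<close> pos_zmult_eq_1_iff[of "r - 2" "r - 1 - m"] by simp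
    then show ?thesis
      using \<open>l = 0\<close> by simp
  qed
qed

section \<open>From a magic labelling to the triangle\<close>

lemma strongly_regular_closed_distance_magic:
  assumes "strongly_regular G" "2 \<le> card (pverts (line_graph G))"
    and magic: "closed_distance_magic (line_graph G)"
  shows "complete_graph G \<and> card (pverts G) = 3"
proof -
  obtain r d where dr: "distance_regular G r d" and d: "d \<le> 2"
    using assms(1) by (auto simp: strongly_regular_def)
  then interpret pair_graph G
    by (simp add: distance_regular_def)
  have reg: "regular_graph G r"
    using dr by (simp add: distance_regular_def regular_graph_def)
  obtain t where ev: "eigenvector G (1 - int r) t"
    and inj: "\<And>u v x y. v \<in> neighbours G u \<Longrightarrow> y \<in> neighbours G x \<Longrightarrow>
      t u + t v = t x + t y \<Longrightarrow> {u, v} = {x, y}"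
    using closed_distance_magic_imp_eigenvector[OF magic reg] by metis
  have \<theta>: "1 - int r \<noteq> int r" by presburger
  obtain e e' where e: "e \<in> pverts (line_graph G)" "e' \<in> pverts (line_graph G)" "e \<noteq> e'"
  proof -
    have "finite (pverts (line_graph G))"
      using finite_edges by (simp add: line_graph_def)
    from card_le_Suc0_iff_eq[OF this] assms(2)
    have "\<not> (\<forall>e \<in> pverts (line_graph G). \<forall>e' \<in> pverts (line_graph G). e = e')"
      by linarith
    then show thesis
      using that by blast
  qed
  obtain u v u' v' where "v \<in> neighbours G u" "e = {u, v}" "v' \<in> neighbours G u'" "e' = {u', v'}"
    using e(1,2) unfolding in_pverts_line_graph_iff neighbours_iff by blast
  with e(3) have uv: "v \<in> neighbours G u" "v' \<in> neighbours G u'" "{u, v} \<noteq> {u', v'}"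
    by simp_all
  \<comment> \<open>Two distinct edges have different sums, so \<open>t\<close> is not the zero
    function and its eigenvalue carries information.\<close>
  then have "t u + t v \<noteq> t u' + t v'"
    using inj by blast
  then have "\<exists>x \<in> {u, v, u', v'}. t x \<noteq> 0"
    by auto
  moreover have "{u, v, u', v'} \<subseteq> pverts G"
    using uv neighbours_subset neighbours_sym by blast
  ultimately obtain x where x: "x \<in> pverts G" "t x \<noteq> 0" by blast
  show ?thesis
  proof (cases "complete_graph G")
    case True
    have "r = 2"
      using eigenvector_complete_graph[OF True ev eigenvector_sum_eq_0[OF reg ev \<theta>] x] by simp
    then have "card (pverts G - {x}) = 2"
      using reg True x(1) unfolding regular_graph_def complete_graph_def by metis
    then show ?thesis
      using True x pair_finite_verts by (simp add: card_Diff_singleton)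
  next
    case False
    obtain l m where srg: "srg G r l m" and lm: "l + 2 \<le> r" "m \<le> r"
      using distance_regular_imp_srg[OF dr d False] .
    from srg_parameters[OF srg_eigenvalue[OF srg ev \<theta> x]] lm
    consider "r = 3" "l = 0" "m = 1" | "3 \<le> r" "l = 1" "m = r"
      by linarith
    then show ?thesis
    proof cases
      case 1
      then have "srg G 3 0 1" "eigenvector G (- 2) t"
        using srg ev by auto
      from petersen_equal_edge_sums[OF this uv(1)] show ?thesis
        using inj uv(1) by metis
    next
      case 2
      then show ?thesis
        using no_srg_r_1_r srg x(1) by metis
    qed
  qed
qed

section \<open>Complete line graphs\<close>

lemma closed_distance_magic_if_complete:
  assumes "finite (pverts H)" "\<And>x. x \<in> pverts H \<Longrightarrow> insert x (neighbours H x) = pverts H"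
  shows "closed_distance_magic H"
proof -
  obtain f where "bij_betw f (pverts H) {1..card (pverts H)}"
    using finite_same_card_bij[OF assms(1), of "{1..card (pverts H)}"] by auto
  then show ?thesis
    unfolding closed_distance_magic_def using assms(2) by auto
qed

text \<open>Two disjoint edges would need four vertices, so the line graph is complete and every
  bijective labelling is magic.\<close>

lemma (in pair_graph) closed_distance_magic_line_graph_triangle:
  assumes "card (pverts G) = 3"
  shows "closed_distance_magic (line_graph G)"
proof (rule closed_distance_magic_if_complete)
  show "finite (pverts (line_graph G))"
    using finite_edges by (simp add: line_graph_def)
next
  have intersect: "e \<inter> f \<noteq> {}" if "e \<in> edges G" "f \<in> edges G" for e f
  proof
    assume "e \<inter> f = {}"
    have ef: "e \<subseteq> pverts G \<and> card e = 2" "f \<subseteq> pverts G \<and> card f = 2"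
      using that in_arcsD1 in_arcsD2 no_loops' by (auto simp: edges_def)
    then have "card (e \<union> f) = 4"
      using \<open>e \<inter> f = {}\<close> finite_subset[OF _ pair_finite_verts] by (simp add: card_Un_disjoint)
    moreover have "card (e \<union> f) \<le> card (pverts G)"
      using ef by (intro card_mono pair_finite_verts) auto
    ultimately show False
      using assms by simp
  qed
  fix e assume "e \<in> pverts (line_graph G)"
  then show "insert e (neighbours (line_graph G) e) = pverts (line_graph G)"
    using intersect by (auto simp: line_graph_def neighbours_def)
qed

section \<open>The triangle\<close>

lemma parcs_cycle_graph_3: "parcs (cycle_graph 3) = {(i, j). i < 3 \<and> j < 3 \<and> i \<noteq> j}"
proof -
  have "j = (i + 1) mod 3 \<or> i = (j + 1) mod 3 \<longleftrightarrow> i \<noteq> j" if "i < 3" "j < 3" for i j :: nat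
  proof -
    have "(k + 1) mod 3 = (if k = 2 then 0 else k + 1)" if "k < 3" for k :: nat
      using that by (cases "k = 2") (simp, subst mod_less, simp_all)
    then show ?thesis
      using that by presburger
  qed
  then show ?thesis
    by (auto simp: cycle_graph_def)
qed

lemma (in pair_graph) is_cycle_of_order_3_iff:
  "is_cycle_of_order G 3 \<longleftrightarrow> complete_graph G \<and> card (pverts G) = 3"
proof
  assume "is_cycle_of_order G 3"
  then obtain h where h: "digraph_isomorphism h" and eq: "with_proj (cycle_graph 3) = app_iso h (with_proj G)"
    unfolding is_cycle_of_order_def digraph_iso_def by blast
  have inj: "inj_on (iso_verts h) (pverts G)"
    using digraph_isomorphism_inj_on_verts[OF h] by simp
  have verts: "iso_verts h ` pverts G = {..<3}"
    using arg_cong[OF eq, of verts] by (simp add: cycle_graph_def)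
  have arcs: "(\<lambda>(u, v). (iso_verts h u, iso_verts h v)) ` parcs G = parcs (cycle_graph 3)"
    using arg_cong[OF eq, of arcs_ends] arcs_ends_app_iso_eq[OF h] by simp
  have "card (pverts G) = 3"
    using card_image[OF inj] verts by simp
  moreover have "(u, v) \<in> parcs G" if uv: "u \<in> pverts G" "v \<in> pverts G" "u \<noteq> v" for u v
  proof -
    have "(iso_verts h u, iso_verts h v) \<in> parcs (cycle_graph 3)"
      using uv verts inj unfolding parcs_cycle_graph_3 by (auto dest: inj_onD)
    then obtain x y where xy: "(x, y) \<in> parcs G" "iso_verts h u = iso_verts h x" "iso_verts h v = iso_verts h y"
      unfolding arcs[symmetric] by auto
    then show ?thesis
      using inj uv in_arcsD1 in_arcsD2 by (metis inj_onD)
  qed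
  ultimately show "complete_graph G \<and> card (pverts G) = 3"
    using in_arcsD2 no_loops' unfolding complete_graph_def neighbours_def by blast
next
  assume K: "complete_graph G \<and> card (pverts G) = 3"
  then obtain \<phi> where \<phi>: "bij_betw \<phi> (pverts G) {..<3::nat}"
    using finite_same_card_bij[OF pair_finite_verts, of "{..<3::nat}"] by auto
  then have inj: "inj_on \<phi> (pverts G)" and img: "\<phi> ` pverts G = {..<3}"
    by (auto simp: bij_betw_def)
  have parcs: "parcs G = {(u, v). u \<in> pverts G \<and> v \<in> pverts G \<and> u \<noteq> v}"
  proof (rule set_eqI, clarify)
    fix u v
    have "(u, v) \<in> parcs G \<longleftrightarrow> u \<in> pverts G \<and> v \<in> neighbours G u"
      using in_arcsD1 by (auto simp: neighbours_iff)
    also have "\<dots> \<longleftrightarrow> (u, v) \<in> {(u, v). u \<in> pverts G \<and> v \<in> pverts G \<and> u \<noteq> v}"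
      using K by (auto simp: complete_graph_def)
    finally show "(u, v) \<in> parcs G \<longleftrightarrow> (u, v) \<in> {(u, v). u \<in> pverts G \<and> v \<in> pverts G \<and> u \<noteq> v}" .
  qed
  \<comment> \<open>Any bijection of the vertices will do, as both graphs are complete. Arcs are
    pairs of vertices, so it acts on them componentwise.\<close>
  define h where "h = \<lparr>iso_verts = \<phi>, iso_arcs = map_prod \<phi> \<phi>, iso_head = snd, iso_tail = fst\<rparr>"
  have "inj_on (map_prod \<phi> \<phi>) (parcs G)"
    using map_prod_inj_on[OF inj inj] by (rule inj_on_subset) (auto simp: parcs)
  then have "digraph_isomorphism h"
    unfolding digraph_isomorphism_def using inj wf_digraph_axioms by (auto simp: h_def)
  moreover have "map_prod \<phi> \<phi> ` parcs G = parcs (cycle_graph 3)"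
  proof (rule set_eqI, clarify)
    fix i j
    have "(i, j) \<in> map_prod \<phi> \<phi> ` parcs G \<longleftrightarrow>
        (\<exists>u \<in> pverts G. \<exists>v \<in> pverts G. i = \<phi> u \<and> j = \<phi> v \<and> u \<noteq> v)"
      unfolding parcs by auto
    also have "\<dots> \<longleftrightarrow> i \<in> \<phi> ` pverts G \<and> j \<in> \<phi> ` pverts G \<and> i \<noteq> j"
      using inj by (auto dest: inj_onD)
    finally show "(i, j) \<in> map_prod \<phi> \<phi> ` parcs G \<longleftrightarrow> (i, j) \<in> parcs (cycle_graph 3)"
      unfolding parcs_cycle_graph_3 img by simp
  qed
  then have "with_proj (cycle_graph 3) = app_iso h (with_proj G)"
    by (simp add: app_iso_def h_def img with_proj_def) (simp add: cycle_graph_def)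
  ultimately show "is_cycle_of_order G 3"
    unfolding is_cycle_of_order_def digraph_iso_def by blast
qed

text \<open>The second assumption leaves out the complete graphs on one and two vertices, whose line
  graphs are trivially magic.\<close>

theorem theorem9:
  fixes G :: "'a pair_pre_digraph"
  assumes "strongly_regular G"
    and "2 \<le> card (pverts (line_graph G))"
  shows "closed_distance_magic (line_graph G) \<longleftrightarrow> is_cycle_of_order G 3"
proof -
  interpret pair_graph G
    using assms(1) by (auto simp: strongly_regular_def distance_regular_def)
  show ?thesis
    using strongly_regular_closed_distance_magic[OF assms] closed_distance_magic_line_graph_triangle
      is_cycle_of_order_3_iff by blast
qed

end
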